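(* Let $A\subseteq\mathbb N$ be any set. There is a basic sequence $Q=(q_n)_{n\in\mathbb N}$ which is limit computable in $A$ (equivalently, computable in the Turing jump $A'$) such that no real number $x\in(0,1)$ computable in $A$ is $Q$-distribution-normal.
   Context: A basic sequence is a sequence $Q=(q_n)_{n\in\mathbb N}$ of integers with $q_n\ge 2$ for all $n$. Given a basic sequence $Q$, a real $x\in(0,1)$ is called $Q$-distribution-normal if the sequence $x,\ q_0x,\ q_0q_1x,\ q_0q_1q_2x,\ \ldots$ is uniformly distributed modulo $1$, i.e., for every interval $I\subseteq[0,1]$ of length $\varepsilon$, the proportion of indices $k<n$ for which the $k$-th term of this sequence, taken mod $1$, lies in $I$ tends to $\varepsilon$ as $n\to\infty$. A real $x\in[0,1]$ is computable in $A$ if $x=\sum_{n}\alpha(n)2^{-n-1}$ for some $\alpha\in 2^{\mathbb N}$ with $\{n:\alpha(n)=1\}$ computable from oracle $A$. A sequence is limit computable in $A$ if it is the pointwise limit of a uniformly $A$-computable sequence of functions. *)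

theory Defs
  imports "HOL-Analysis.Analysis" "HOL-Library.Nat_Bijection"
begin

text \<open>
  Relativised computability is modelled by mu-recursive programs with an additional basic
  function, the characteristic function of a set \<open>A\<close>. Programs carry no arity: each of them
  denotes a partial function on argument lists, and for every \<open>k\<close> its restriction to lists of
  length \<open>k\<close> is a \<open>k\<close>-ary partial function that is recursive in \<open>A\<close> (possibly nowhere defined).
\<close>

datatype prog =
    Zero
  | Succ
  | Query
  | Proj nat
  | Comp prog "prog list"
  | PrimRec prog prog
  | Mu prog

text \<open>\<open>evaluates A p xs y\<close>: program \<open>p\<close>, relative to \<open>A\<close>, halts on \<open>xs\<close> with output \<open>y\<close>.\<close>

inductive evaluates :: "nat set \<Rightarrow> prog \<Rightarrow> nat list \<Rightarrow> nat \<Rightarrow> bool" for A :: "nat set" where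
  zero: "evaluates A Zero xs 0"
| succ: "evaluates A Succ [x] (Suc x)"
| query: "evaluates A Query [x] (if x \<in> A then 1 else 0)"
| proj: "i < length xs \<Longrightarrow> evaluates A (Proj i) xs (xs ! i)"
| comp: "list_all2 (\<lambda>g y. evaluates A g xs y) gs ys \<Longrightarrow> evaluates A f ys z
    \<Longrightarrow> evaluates A (Comp f gs) xs z"
| prim_zero: "evaluates A f xs y \<Longrightarrow> evaluates A (PrimRec f g) (0 # xs) y"
| prim_Suc: "evaluates A (PrimRec f g) (n # xs) r \<Longrightarrow> evaluates A g (n # r # xs) y
    \<Longrightarrow> evaluates A (PrimRec f g) (Suc n # xs) y"
| mu: "evaluates A f (n # xs) 0 \<Longrightarrow> (\<And>m. m < n \<Longrightarrow> \<exists>y. 0 < y \<and> evaluates A f (m # xs) y)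
    \<Longrightarrow> evaluates A (Mu f) xs n"

inductive_cases evaluates_ZeroE: "evaluates A Zero xs y"
inductive_cases evaluates_SuccE: "evaluates A Succ xs y"
inductive_cases evaluates_QueryE: "evaluates A Query xs y"
inductive_cases evaluates_ProjE: "evaluates A (Proj i) xs y"
inductive_cases evaluates_CompE: "evaluates A (Comp f gs) xs y"
inductive_cases evaluates_PrimRec_0E: "evaluates A (PrimRec f g) (0 # xs) y"
inductive_cases evaluates_PrimRec_SucE: "evaluates A (PrimRec f g) (Suc n # xs) y"
inductive_cases evaluates_MuE: "evaluates A (Mu f) xs y"

lemma evaluates_deterministic: "evaluates A p xs y \<Longrightarrow> evaluates A p xs z \<Longrightarrow> y = z"
proof (induction arbitrary: z rule: evaluates.induct)
  case (comp xs gs ys f w)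
  from comp.prems obtain ys' where ys': "list_all2 (\<lambda>g y. evaluates A g xs y) gs ys'"
    and z: "evaluates A f ys' z"
    by (blast elim: evaluates_CompE)
  have "ys = ys'"
  proof (rule nth_equalityI)
    show "length ys = length ys'"
      using comp.IH(1) ys' by (auto dest!: list_all2_lengthD)
  next
    fix i assume "i < length ys"
    then show "ys ! i = ys' ! i"
      using comp.IH(1) ys' by (auto simp: list_all2_conv_all_nth)
  qed
  with comp.IH(2) z show ?case by blast
next
  case (prim_Suc f g n xs r y)
  from prim_Suc.prems obtain r' where "evaluates A (PrimRec f g) (n # xs) r'"
    and "evaluates A g (n # r' # xs) z"
    by (blast elim: evaluates_PrimRec_SucE)
  with prim_Suc.IH show ?case by blast
next
  case (mu f n xs)
  from mu.prems have "evaluates A f (z # xs) 0 \<and>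
      (\<forall>m<z. \<exists>y. 0 < y \<and> evaluates A f (m # xs) y)"
    by (elim evaluates_MuE) simp
  then have z: "evaluates A f (z # xs) 0"
    and less: "\<And>m. m < z \<Longrightarrow> \<exists>y. 0 < y \<and> evaluates A f (m # xs) y"
    by simp_all
  have "\<not> n < z" using less mu.IH(1) by fastforce
  moreover have "\<not> z < n" using mu.IH(2) z by fastforce
  ultimately show ?case by simp
next
  case (zero xs) then show ?case by (blast elim: evaluates_ZeroE)
next
  case (succ x) then show ?case by (blast elim: evaluates_SuccE)
next
  case (query x) then show ?case by (elim evaluates_QueryE) simp
next
  case (proj i xs) then show ?case by (blast elim: evaluates_ProjE)
next
  case (prim_zero f xs y g)
  from prim_zero.prems have "evaluates A f xs z" by (rule evaluates_PrimRec_0E)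
  then show ?case by (rule prim_zero.IH)
qed

definition computable_in :: "nat set \<Rightarrow> (nat \<Rightarrow> nat) \<Rightarrow> bool" where
  "computable_in A f \<longleftrightarrow> (\<exists>p. \<forall>n. evaluates A p [n] (f n))"

definition uniformly_computable_in :: "nat set \<Rightarrow> (nat \<Rightarrow> nat \<Rightarrow> nat) \<Rightarrow> bool" where
  "uniformly_computable_in A g \<longleftrightarrow> (\<exists>p. \<forall>s n. evaluates A p [s, n] (g s n))"

definition computable_set_in :: "nat set \<Rightarrow> nat set \<Rightarrow> bool" where
  "computable_set_in A B \<longleftrightarrow> computable_in A (\<lambda>n. if n \<in> B then 1 else 0)"

text \<open>The limit is taken in the (discrete) standard topology of \<^typ>\<open>nat\<close>.\<close>

definition limit_computable_in :: "nat set \<Rightarrow> (nat \<Rightarrow> nat) \<Rightarrow> bool" where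
  "limit_computable_in A f \<longleftrightarrow>
    (\<exists>g. uniformly_computable_in A g \<and> (\<forall>n. (\<lambda>s. g s n) \<longlonglongrightarrow> f n))"

text \<open>An effective Goedel numbering of programs, needed for the Turing jump.\<close>

primrec code :: "prog \<Rightarrow> nat" where
  "code Zero = prod_encode (0, 0)"
| "code Succ = prod_encode (1, 0)"
| "code Query = prod_encode (2, 0)"
| "code (Proj i) = prod_encode (3, i)"
| "code (Comp f gs) = prod_encode (4, prod_encode (code f, list_encode (map code gs)))"
| "code (PrimRec f g) = prod_encode (5, prod_encode (code f, code g))"
| "code (Mu f) = prod_encode (6, code f)"

lemma code_inject: "code p = code q \<Longrightarrow> p = q"
proof (induction p arbitrary: q)
  case (Comp f gs)
  then obtain f' gs' where q: "q = Comp f' gs'" by (cases q) auto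
  with Comp.prems have f: "code f = code f'" and gs: "map code gs = map code gs'"
    by (simp_all add: list_encode_eq)
  have "gs = gs'"
  proof (rule nth_equalityI)
    show len: "length gs = length gs'" using gs by (rule map_eq_imp_length_eq)
    fix i assume i: "i < length gs"
    then have "code (gs ! i) = code (gs' ! i)" using gs len by (metis nth_map)
    with i show "gs ! i = gs' ! i" using Comp.IH(2) nth_mem by blast
  qed
  with f q Comp.IH(1) show ?case by blast
next
  case Zero then show ?case by (cases q) auto
next
  case Succ then show ?case by (cases q) auto
next
  case Query then show ?case by (cases q) auto
next
  case (Proj i) then show ?case by (cases q) auto
next
  case (PrimRec f g) then show ?case by (cases q) auto
next
  case (Mu f) then show ?case by (cases q) auto
qed

definition turing_jump :: "nat set \<Rightarrow> nat set" where
  "turing_jump A = {code p | p. \<exists>y. evaluates A p [code p] y}"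

definition computable_real_in :: "nat set \<Rightarrow> real \<Rightarrow> bool" where
  "computable_real_in A x \<longleftrightarrow>
    (\<exists>\<alpha> :: nat \<Rightarrow> nat. (\<forall>n. \<alpha> n \<in> {0, 1}) \<and> computable_set_in A {n. \<alpha> n = 1} \<and>
      (\<lambda>n. real (\<alpha> n) / 2 ^ (n + 1)) sums x)"

definition basic_sequence :: "(nat \<Rightarrow> nat) \<Rightarrow> bool" where
  "basic_sequence Q \<longleftrightarrow> (\<forall>n. Q n \<ge> 2)"

text \<open>The interval \<open>I\<close> may be open, closed or half-open; its length is its Lebesgue measure.\<close>

definition uniformly_distributed_mod1 :: "(nat \<Rightarrow> real) \<Rightarrow> bool" where
  "uniformly_distributed_mod1 u \<longleftrightarrow>
    (\<forall>I. is_interval I \<and> I \<subseteq> {0..1} \<longrightarrow>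
      (\<lambda>n. real (card {k. k < n \<and> frac (u k) \<in> I}) / real n) \<longlonglongrightarrow> measure lborel I)"

definition distribution_normal :: "(nat \<Rightarrow> nat) \<Rightarrow> real \<Rightarrow> bool" where
  "distribution_normal Q x \<longleftrightarrow>
    uniformly_distributed_mod1 (\<lambda>k. real (\<Prod>i<k. Q i) * x)"

end

theory Submission
  imports Defs
begin

text \<open>
  \<open>Q\<close> is built one term at a time. Block \<open>{4 ^ j..<4 ^ (j + 1)}\<close> of indices is devoted to a
  single program computing a real \<open>x\<close>, and every program owns infinitely many blocks. With
  \<open>p = q_0 * ... * q_(n - 1)\<close>, the next term \<open>q\<close> is the first one found for which finitely many
  digits of \<open>x\<close> certify \<open>frac (q * p * x) \<le> 2 / 3\<close>. Such a \<open>q\<close> exists unless \<open>p * x\<close> is an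
  integer, and then \<open>frac (2 * p * x) = 0\<close>. So at the end of each block of \<open>x\<close> about 3/4 of the
  terms so far, or more, lie in \<open>{0..2 / 3}\<close>. The search is an
  unbounded one for a decidable condition, hence its outcome is limit computable, and stays so
  along the recursion on \<open>n\<close>.
\<close>

section \<open>Closure properties of relative computability\<close>

definition nfst :: "nat \<Rightarrow> nat" where "nfst z = fst (prod_decode z)"
definition nsnd :: "nat \<Rightarrow> nat" where "nsnd z = snd (prod_decode z)"

lemma nfst_prod_encode [simp]: "nfst (prod_encode (x, y)) = x"
  and nsnd_prod_encode [simp]: "nsnd (prod_encode (x, y)) = y"
  by (simp_all add: nfst_def nsnd_def)

definition decidable_in :: "nat set \<Rightarrow> (nat \<Rightarrow> bool) \<Rightarrow> bool" where
  "decidable_in A P \<longleftrightarrow> computable_in A (\<lambda>n. if P n then 1 else 0)"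

lemma evaluates_Comp1:
  "evaluates A g xs y \<Longrightarrow> evaluates A f [y] z \<Longrightarrow> evaluates A (Comp f [g]) xs z"
  by (rule evaluates.comp[where ys = "[y]"]) simp_all

lemma evaluates_Comp2:
  "evaluates A g xs y \<Longrightarrow> evaluates A h xs y' \<Longrightarrow> evaluates A f [y, y'] z
    \<Longrightarrow> evaluates A (Comp f [g, h]) xs z"
  by (rule evaluates.comp[where ys = "[y, y']"]) simp_all

lemma evaluates_Proj: "i < length xs \<Longrightarrow> xs ! i = y \<Longrightarrow> evaluates A (Proj i) xs y"
  using evaluates.proj by blast

lemma computable_id: "computable_in A (\<lambda>n. n)"
  unfolding computable_in_def by (rule exI[of _ "Proj 0"]) (simp add: evaluates_Proj)

lemma computable_comp:
  assumes "computable_in A f" and "computable_in A g"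
  shows "computable_in A (\<lambda>n. f (g n))"
  using assms unfolding computable_in_def by (meson evaluates_Comp1)

lemma computable_comp2:
  assumes "uniformly_computable_in A h" and "computable_in A f" and "computable_in A g"
  shows "computable_in A (\<lambda>n. h (f n) (g n))"
  using assms unfolding computable_in_def uniformly_computable_in_def by (meson evaluates_Comp2)

lemma uniformly_computable_fst: "uniformly_computable_in A (\<lambda>x y. x)"
  unfolding uniformly_computable_in_def
  by (rule exI[of _ "Proj 0"]) (simp add: evaluates_Proj)

lemma uniformly_computable_snd: "uniformly_computable_in A (\<lambda>x y. y)"
  unfolding uniformly_computable_in_def
  by (rule exI[of _ "Proj 1"]) (simp add: evaluates_Proj)

lemma uniformly_computable_comp:
  assumes "computable_in A f" and "uniformly_computable_in A g"
  shows "uniformly_computable_in A (\<lambda>x y. f (g x y))"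
  using assms unfolding computable_in_def uniformly_computable_in_def by (meson evaluates_Comp1)

lemma uniformly_computable_comp2:
  assumes "uniformly_computable_in A h" and "uniformly_computable_in A f"
    and "uniformly_computable_in A g"
  shows "uniformly_computable_in A (\<lambda>x y. h (f x y) (g x y))"
  using assms unfolding uniformly_computable_in_def by (meson evaluates_Comp2)

lemma computable_Suc_id: "computable_in A Suc"
  unfolding computable_in_def using evaluates.succ by blast

lemma computable_Suc: "computable_in A f \<Longrightarrow> computable_in A (\<lambda>x. Suc (f x))"
  by (rule computable_comp[OF computable_Suc_id])

lemma computable_const: "computable_in A (\<lambda>x. c)"
proof (induction c)
  case 0
  show ?case unfolding computable_in_def using evaluates.zero by blast
next
  case (Suc c)
  then show ?case by (rule computable_Suc)
qed

lemma computable_rec0: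
  assumes "uniformly_computable_in A h"
  shows "computable_in A (rec_nat 0 h)"
proof -
  obtain p where p: "evaluates A p [k, r] (h k r)" for k r
    using assms unfolding uniformly_computable_in_def by blast
  have "evaluates A (PrimRec Zero p) [n] (rec_nat 0 h n)" for n
    by (induction n) (auto intro: evaluates.intros p)
  then show ?thesis unfolding computable_in_def by blast
qed

text \<open>Recursion whose step sees the parameter but not the counter is enough for sums, products
  and truncated differences. Pairing and unpairing rest on these, and only then can the general rule
  \<open>computable_rec\<close> pack its environment into one number.\<close>

lemma uniformly_computable_iterate:
  assumes "computable_in A f" and "uniformly_computable_in A h"
  shows "uniformly_computable_in A (\<lambda>n x. rec_nat (f x) (\<lambda>_ r. h r x) n)"
proof -
  obtain p where p: "evaluates A p [x] (f x)" for x
    using assms unfolding computable_in_def by blast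
  obtain q where q: "evaluates A q [k, r] (h k r)" for k r
    using assms unfolding uniformly_computable_in_def by blast
  have step: "evaluates A (Comp q [Proj (Suc 0), Proj 2]) [k, r, x] (h r x)" for k r x
    by (rule evaluates_Comp2[OF _ _ q]) (simp_all add: evaluates_Proj)
  have "evaluates A (PrimRec p (Comp q [Proj (Suc 0), Proj 2])) [n, x]
      (rec_nat (f x) (\<lambda>_ r. h r x) n)" for n x
    by (induction n) (auto intro: evaluates.prim_zero evaluates.prim_Suc p step)
  then show ?thesis unfolding uniformly_computable_in_def by blast
qed

section \<open>Arithmetic and the pairing function\<close>

lemma uniformly_computable_add: "uniformly_computable_in A (+)"
proof -
  have "rec_nat x (\<lambda>_ r. Suc r) n = n + x" for n x :: nat
    by (induction n) simp_all
  then show ?thesis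
    using uniformly_computable_iterate[OF computable_id
        uniformly_computable_comp[OF computable_Suc_id uniformly_computable_fst], of A] by simp
qed

lemma uniformly_computable_mult: "uniformly_computable_in A (*)"
proof -
  have "rec_nat 0 (\<lambda>_ r. r + x) n = n * x" for n x :: nat
    by (induction n) simp_all
  then show ?thesis
    using uniformly_computable_iterate[OF computable_const[of A 0] uniformly_computable_add]
    by simp
qed

lemma computable_pred_id: "computable_in A (\<lambda>n. n - 1)"
proof -
  have "rec_nat 0 (\<lambda>k r. k) = (\<lambda>n. n - 1 :: nat)"
  proof
    fix n :: nat show "rec_nat 0 (\<lambda>k r. k) n = n - 1" by (cases n) simp_all
  qed
  then show ?thesis using computable_rec0[OF uniformly_computable_fst, of A] by metis
qed

lemma uniformly_computable_minus: "uniformly_computable_in A (-)"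
proof -
  have "rec_nat x (\<lambda>_ r. r - 1) n = x - n" for n x :: nat
    by (induction n) simp_all
  then have "uniformly_computable_in A (\<lambda>n x. x - n)"
    using uniformly_computable_iterate[OF computable_id
        uniformly_computable_comp[OF computable_pred_id uniformly_computable_fst], of A] by simp
  from uniformly_computable_comp2[OF this uniformly_computable_snd uniformly_computable_fst]
  show ?thesis by simp
qed

lemma computable_add:
  "computable_in A f \<Longrightarrow> computable_in A g \<Longrightarrow> computable_in A (\<lambda>x. f x + g x)"
  by (rule computable_comp2[OF uniformly_computable_add])

lemma computable_mult:
  "computable_in A f \<Longrightarrow> computable_in A g \<Longrightarrow> computable_in A (\<lambda>x. f x * g x)"
  by (rule computable_comp2[OF uniformly_computable_mult])

lemma computable_minus:
  "computable_in A f \<Longrightarrow> computable_in A g \<Longrightarrow> computable_in A (\<lambda>x. f x - g x)"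
  by (rule computable_comp2[OF uniformly_computable_minus])

lemma computable_triangle: "computable_in A triangle"
proof -
  have "rec_nat 0 (\<lambda>k r. r + Suc k) = triangle"
  proof
    fix n show "rec_nat 0 (\<lambda>k r. r + Suc k) n = triangle n" by (induction n) simp_all
  qed
  then show ?thesis
    using computable_rec0[OF uniformly_computable_comp2[OF uniformly_computable_add
          uniformly_computable_snd
          uniformly_computable_comp[OF computable_Suc_id uniformly_computable_fst]], of A]
    by metis
qed

lemma uniformly_computable_prod_encode: "uniformly_computable_in A (\<lambda>x y. prod_encode (x, y))"
  unfolding prod_encode_def prod.case
  by (intro uniformly_computable_comp2[OF uniformly_computable_add]
      uniformly_computable_comp[OF computable_triangle] uniformly_computable_add
      uniformly_computable_fst)

lemma computable_prod_encode:
  "computable_in A f \<Longrightarrow> computable_in A g \<Longrightarrow> computable_in A (\<lambda>x. prod_encode (f x, g x))"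
  by (rule computable_comp2[OF uniformly_computable_prod_encode])

lemma computable_Mu:
  assumes "uniformly_computable_in A f" and ex: "\<And>x. \<exists>i. f i x = 0"
  shows "computable_in A (\<lambda>x. LEAST i. f i x = 0)"
proof -
  obtain p where p: "evaluates A p [i, x] (f i x)" for i x
    using assms unfolding uniformly_computable_in_def by blast
  have "evaluates A (Mu p) [x] (LEAST i. f i x = 0)" for x
  proof (rule evaluates.mu)
    have "f (LEAST i. f i x = 0) x = 0"
      using ex[of x] by (rule LeastI_ex)
    then show "evaluates A p [LEAST i. f i x = 0, x] 0"
      using p by metis
  next
    fix m assume "m < (LEAST i. f i x = 0)"
    then have "0 < f m x" using not_less_Least by blast
    then show "\<exists>y>0. evaluates A p [m, x] y" using p by blast
  qed
  then show ?thesis unfolding computable_in_def by blast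
qed

lemma triangle_mono: "m \<le> n \<Longrightarrow> triangle m \<le> triangle n"
  by (induction rule: dec_induct) simp_all

text \<open>Since \<open>prod_encode (x, y)\<close> is \<open>triangle (x + y) + x\<close>, the
  first triangular number beyond it reveals \<open>x + y\<close>. The strict inequality is written
  as a vanishing truncated difference, the form that \<open>computable_Mu\<close> searches
  for.\<close>

lemma Least_triangle: "(LEAST w. Suc (prod_encode (x, y)) - triangle (Suc w) = 0) = x + y"
proof (rule Least_equality)
  fix w assume "Suc (prod_encode (x, y)) - triangle (Suc w) = 0"
  then have less: "triangle (x + y) < triangle (Suc w)"
    by (simp add: prod_encode_def)
  show "x + y \<le> w"
  proof (rule ccontr)
    assume "\<not> x + y \<le> w"
    then have "triangle (Suc w) \<le> triangle (x + y)" by (intro triangle_mono) simp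
    with less show False by simp
  qed
qed (simp add: prod_encode_def)

lemma computable_nfst_id: "computable_in A nfst"
  and computable_nsnd_id: "computable_in A nsnd"
proof -
  define w where "w z = (LEAST w. Suc z - triangle (Suc w) = 0)" for z
  have w: "w (prod_encode (x, y)) = x + y" for x y
    unfolding w_def by (rule Least_triangle)
  have w_computable: "computable_in A w"
    unfolding w_def
  proof (rule computable_Mu)
    show "uniformly_computable_in A (\<lambda>w z. Suc z - triangle (Suc w))"
      by (intro uniformly_computable_comp2[OF uniformly_computable_minus]
          uniformly_computable_comp[OF computable_triangle]
          uniformly_computable_comp[OF computable_Suc_id]
          uniformly_computable_fst uniformly_computable_snd)
    fix z show "\<exists>i. Suc z - triangle (Suc i) = 0"
      by (rule exI[of _ z]) simp
  qed
  \<comment> \<open>The first component is the offset of \<open>z\<close> above its triangular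
    number; the second is what remains of the recovered sum \<open>w z\<close>.\<close>
  have nfst: "nfst z = z - triangle (w z)" for z
  proof -
    obtain x y where "z = prod_encode (x, y)" by (metis prod_decode_inverse surj_pair)
    then show ?thesis by (simp add: w) (simp add: prod_encode_def)
  qed
  have nsnd: "nsnd z = w z - nfst z" for z
  proof -
    obtain x y where "z = prod_encode (x, y)" by (metis prod_decode_inverse surj_pair)
    then show ?thesis by (simp add: w)
  qed
  show fst: "computable_in A nfst"
    unfolding nfst[abs_def]
    by (intro computable_minus computable_id computable_comp[OF computable_triangle] w_computable)
  show "computable_in A nsnd"
    unfolding nsnd[abs_def] by (intro computable_minus fst w_computable)
qed

lemma computable_nfst: "computable_in A f \<Longrightarrow> computable_in A (\<lambda>x. nfst (f x))"
  by (rule computable_comp[OF computable_nfst_id])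

lemma computable_nsnd: "computable_in A f \<Longrightarrow> computable_in A (\<lambda>x. nsnd (f x))"
  by (rule computable_comp[OF computable_nsnd_id])

text \<open>Turns functions of several arguments into unary functions of pair codes, so that the
  closure rules for \<open>computable_in\<close> serve all of them.\<close>

lemma uniformly_computable_iff:
  "uniformly_computable_in A g \<longleftrightarrow> computable_in A (\<lambda>z. g (nfst z) (nsnd z))"
proof
  assume "uniformly_computable_in A g"
  then show "computable_in A (\<lambda>z. g (nfst z) (nsnd z))"
    by (rule computable_comp2) (intro computable_nfst_id computable_nsnd_id)+
next
  assume "computable_in A (\<lambda>z. g (nfst z) (nsnd z))"
  from uniformly_computable_comp[OF this uniformly_computable_prod_encode]
  show "uniformly_computable_in A g" by simp
qed

text \<open>In the binder rules below, a pair code serves as an environment: its components stand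
  for the old environment and the bound variable.\<close>

lemma computable_rec:
  assumes "computable_in A f" and "computable_in A n"
    and "computable_in A (\<lambda>z. g (nfst z) (nfst (nsnd z)) (nsnd (nsnd z)))"
  shows "computable_in A (\<lambda>x. rec_nat (f x) (g x) (n x))"
proof -
  obtain p where p: "evaluates A p [x] (f x)" for x
    using assms unfolding computable_in_def by blast
  obtain q where q: "evaluates A q [z] (g (nfst z) (nfst (nsnd z)) (nsnd (nsnd z)))" for z
    using assms unfolding computable_in_def by blast
  obtain e where e: "evaluates A e [x, y] (prod_encode (x, y))" for x y
    using uniformly_computable_prod_encode unfolding uniformly_computable_in_def by blast
  define q' where "q' = Comp q [Comp e [Proj 2, Comp e [Proj 0, Proj 1]]]"
  have q': "evaluates A q' [k, r, x] (g x k r)" for k r x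
    using q[of "prod_encode (x, prod_encode (k, r))"] unfolding q'_def
    by (auto intro!: evaluates_Comp1 evaluates_Comp2 e evaluates_Proj)
  have "evaluates A (PrimRec p q') [n, x] (rec_nat (f x) (g x) n)" for n x
    by (induction n) (auto intro: evaluates.prim_zero evaluates.prim_Suc p q')
  then have "uniformly_computable_in A (\<lambda>n x. rec_nat (f x) (g x) n)"
    unfolding uniformly_computable_in_def by blast
  from computable_comp2[OF this assms(2) computable_id] show ?thesis .
qed

section \<open>Decidable predicates, search and bounded operations\<close>

lemma decidable_le:
  assumes "computable_in A f" and "computable_in A g"
  shows "decidable_in A (\<lambda>x. f x \<le> g x)"
proof -
  have "computable_in A (\<lambda>x. 1 - (f x - g x))"
    by (intro computable_minus computable_const assms)
  also have "(\<lambda>x. 1 - (f x - g x)) = (\<lambda>x. if f x \<le> g x then 1 else 0)" by auto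
  finally show ?thesis unfolding decidable_in_def .
qed

lemma decidable_less:
  "computable_in A f \<Longrightarrow> computable_in A g \<Longrightarrow> decidable_in A (\<lambda>x. f x < g x)"
  unfolding Suc_le_eq[symmetric] by (intro decidable_le computable_Suc)

lemma decidable_not:
  assumes "decidable_in A P"
  shows "decidable_in A (\<lambda>x. \<not> P x)"
proof -
  have "computable_in A (\<lambda>x. 1 - (if P x then 1 else 0))"
    using assms unfolding decidable_in_def by (intro computable_minus computable_const)
  also have "(\<lambda>x. 1 - (if P x then 1 else 0)) = (\<lambda>x. if \<not> P x then 1 else 0 :: nat)" by auto
  finally show ?thesis unfolding decidable_in_def .
qed

lemma decidable_conj:
  assumes "decidable_in A P" and "decidable_in A Q"
  shows "decidable_in A (\<lambda>x. P x \<and> Q x)"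
proof -
  have "computable_in A (\<lambda>x. (if P x then 1 else 0) * (if Q x then 1 else 0))"
    using assms unfolding decidable_in_def by (rule computable_mult)
  also have "(\<lambda>x. (if P x then 1 else 0) * (if Q x then 1 else 0)) =
      (\<lambda>x. if P x \<and> Q x then 1 else 0 :: nat)" by auto
  finally show ?thesis unfolding decidable_in_def .
qed

lemma decidable_disj:
  assumes "decidable_in A P" and "decidable_in A Q"
  shows "decidable_in A (\<lambda>x. P x \<or> Q x)"
  using decidable_not[OF decidable_conj[OF assms[THEN decidable_not]]] by simp

lemma decidable_eq:
  "computable_in A f \<Longrightarrow> computable_in A g \<Longrightarrow> decidable_in A (\<lambda>x. f x = g x)"
  unfolding order_eq_iff[of "f _"] by (intro decidable_conj decidable_le)

lemma decidable_oracle: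
  assumes "computable_in A f"
  shows "decidable_in A (\<lambda>x. f x \<in> A)"
proof -
  have "computable_in A (\<lambda>n. if n \<in> A then 1 else 0)"
    unfolding computable_in_def using evaluates.query by blast
  from computable_comp[OF this assms] show ?thesis unfolding decidable_in_def .
qed

lemma computable_If:
  assumes "decidable_in A P" and "computable_in A f" and "computable_in A g"
  shows "computable_in A (\<lambda>x. if P x then f x else g x)"
proof -
  have "computable_in A (\<lambda>x. (if P x then 1 else 0) * f x + (if \<not> P x then 1 else 0) * g x)"
    using assms(1) decidable_not[OF assms(1)] unfolding decidable_in_def
    by (intro computable_add computable_mult assms(2,3))
  also have "(\<lambda>x. (if P x then 1 else 0) * f x + (if \<not> P x then 1 else 0) * g x) =
      (\<lambda>x. if P x then f x else g x)" by auto
  finally show ?thesis .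
qed

lemma computable_Least:
  assumes "decidable_in A (\<lambda>z. P (nfst z) (nsnd z))" and "\<And>x. \<exists>i. P x i"
  shows "computable_in A (\<lambda>x. LEAST i. P x i)"
proof -
  define f where "f i x = (if \<not> P x i then 1 else 0 :: nat)" for i x
  have "computable_in A (\<lambda>z. f (nsnd z) (nfst z))"
    using decidable_not[OF assms(1)] unfolding f_def decidable_in_def .
  then have "uniformly_computable_in A (\<lambda>x i. f i x)"
    by (simp add: uniformly_computable_iff)
  from uniformly_computable_comp2[OF this uniformly_computable_snd uniformly_computable_fst]
  have "uniformly_computable_in A f" .
  then have "computable_in A (\<lambda>x. LEAST i. f i x = 0)"
    by (rule computable_Mu) (simp add: f_def assms(2))
  moreover have "f i x = 0 \<longleftrightarrow> P x i" for i x by (simp add: f_def)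
  ultimately show ?thesis by simp
qed

text \<open>The search for a counterexample is made total by the cap \<open>n x\<close>, which it
  reaches exactly when there is no counterexample below.\<close>

lemma decidable_ball:
  assumes "decidable_in A (\<lambda>z. P (nfst z) (nsnd z))" and "computable_in A n"
  shows "decidable_in A (\<lambda>x. \<forall>i<n x. P x i)"
proof -
  have "n x \<le> (LEAST i. n x \<le> i \<or> \<not> P x i) \<longleftrightarrow> (\<forall>i<n x. P x i)" for x
  proof
    assume le: "n x \<le> (LEAST i. n x \<le> i \<or> \<not> P x i)"
    show "\<forall>i<n x. P x i"
    proof (intro allI impI)
      fix i assume "i < n x"
      with le have "i < (LEAST i. n x \<le> i \<or> \<not> P x i)" by (rule less_le_trans[rotated])
      from not_less_Least[OF this] show "P x i" by simp
    qed
  next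
    assume "\<forall>i<n x. P x i"
    then show "n x \<le> (LEAST i. n x \<le> i \<or> \<not> P x i)"
      using LeastI[of "\<lambda>i. n x \<le> i \<or> \<not> P x i" "n x"] by (meson le_refl not_less)
  qed
  moreover have "decidable_in A (\<lambda>x. n x \<le> (LEAST i. n x \<le> i \<or> \<not> P x i))"
    by (intro decidable_le computable_Least decidable_disj decidable_not assms computable_nsnd_id
        computable_comp[OF assms(2)] computable_nfst_id) auto
  ultimately show ?thesis by simp
qed

lemma decidable_bex:
  assumes "decidable_in A (\<lambda>z. P (nfst z) (nsnd z))" and "computable_in A n"
  shows "decidable_in A (\<lambda>x. \<exists>i<n x. P x i)"
  using decidable_not[OF decidable_ball[OF decidable_not[OF assms(1)] assms(2)]] by simp

lemma computable_sum:
  assumes "computable_in A (\<lambda>z. f (nfst z) (nsnd z))" and "computable_in A n"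
  shows "computable_in A (\<lambda>x. \<Sum>i<n x. f x i)"
proof -
  \<comment> \<open>The recursion rule presents the environment \<open>(x, (i, r))\<close>; the
    accumulator \<open>r\<close> has to be dropped before \<open>f\<close> is applied.\<close>
  have f: "computable_in A (\<lambda>z. f (nfst z) (nfst (nsnd z)))"
    using computable_comp[OF assms(1),
        of "\<lambda>z. prod_encode (nfst z, nfst (nsnd z))"]
    by (simp add: computable_prod_encode computable_nfst computable_nsnd computable_id)
  have "(\<Sum>i<n. f x i) = rec_nat 0 (\<lambda>i r. f x i + r) n" for n x
    by (induction n) (simp_all add: add.commute)
  then show ?thesis
    by (simp only:) (intro computable_rec computable_const assms(2) computable_add f
        computable_nsnd computable_id)
qed

lemma computable_funpow:
  assumes "computable_in A f" and "computable_in A n" and "computable_in A g"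
  shows "computable_in A (\<lambda>x. (f ^^ n x) (g x))"
proof -
  have "(f ^^ n) y = rec_nat y (\<lambda>_ r. f r) n" for n y
    by (induction n) simp_all
  then show ?thesis
    by (simp only:) (intro computable_rec assms computable_comp[OF assms(1)]
        computable_nsnd computable_id)
qed

lemma computable_power:
  assumes "computable_in A f" and "computable_in A g"
  shows "computable_in A (\<lambda>x. f x ^ g x)"
proof -
  have "y ^ n = rec_nat 1 (\<lambda>_ r. y * r) n" for n and y :: nat
    by (induction n) simp_all
  then show ?thesis
    by (simp only:) (intro computable_rec assms computable_const computable_mult
        computable_comp[OF assms(1)] computable_nsnd computable_nfst computable_id)
qed

lemma computable_div:
  assumes "computable_in A f" and "computable_in A g"
  shows "computable_in A (\<lambda>x. f x div g x)"
proof -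
  \<comment> \<open>The disjunct \<open>b = 0\<close> lets the search stop at 0, which is the
    convention for division by zero.\<close>
  have "a div b = (LEAST q. b = 0 \<or> a < b * Suc q)" for a b :: nat
  proof (rule sym, rule Least_equality)
    show "b = 0 \<or> a < b * Suc (a div b)"
      by (metis dividend_less_times_div gr0I mult_Suc_right)
    fix q assume "b = 0 \<or> a < b * Suc q"
    then show "a div b \<le> q"
      by (metis div_by_0 le0 less_Suc_eq_le less_mult_imp_div_less mult.commute)
  qed
  then show ?thesis
    by (simp only:) (intro computable_Least decidable_disj decidable_eq decidable_less
        computable_comp[OF assms(1)] computable_comp[OF assms(2)] computable_mult computable_Suc
        computable_const computable_nsnd computable_nfst computable_id;
        metis dividend_less_times_div gr0I mult_Suc_right)
qed

lemma computable_mod: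
  "computable_in A f \<Longrightarrow> computable_in A g \<Longrightarrow> computable_in A (\<lambda>x. f x mod g x)"
  unfolding minus_mult_div_eq_mod[symmetric]
  by (intro computable_minus computable_mult computable_div)

lemmas computable_intros =
  computable_id computable_const computable_Suc computable_add computable_mult computable_minus
  computable_prod_encode computable_nfst computable_nsnd computable_If computable_power
  computable_div computable_mod computable_sum
  decidable_le decidable_less decidable_eq decidable_not decidable_conj decidable_disj
  decidable_oracle decidable_ball decidable_bex

lemma decidable_mem_set_decode:
  assumes "computable_in A f" and "computable_in A g"
  shows "decidable_in A (\<lambda>x. f x \<in> set_decode (g x))"
  unfolding set_decode_def mem_Collect_eq odd_iff_mod_2_eq_one
  by (intro computable_intros assms)

lemma computable_set_encode:
  assumes "decidable_in A (\<lambda>z. P (nfst z) (nsnd z))" and "computable_in A n"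
  shows "computable_in A (\<lambda>x. set_encode {t. t < n x \<and> P x t})"
proof -
  have "set_encode {t. t < n \<and> Q t} = (\<Sum>t<n. if Q t then 2 ^ t else 0)" for n Q
    unfolding set_encode_def
    using sum.inter_filter[of "{..<n}" "\<lambda>t. 2 ^ t :: nat" Q] by (simp add: lessThan_def)
  then show ?thesis
    by (simp only:) (intro computable_intros assms)
qed

section \<open>Finite approximations of the evaluation relation\<close>

text \<open>List operations on \<open>list_encode\<close> codes, where 0 codes the empty list and a
  successor codes the pair of head and tail. The tail of 0 is again 0, matching
  \<open>tl [] = []\<close>, so the number of tails taken before 0 appears is the length.\<close>

definition lhd :: "nat \<Rightarrow> nat" where "lhd c = nfst (c - 1)"
definition ltl :: "nat \<Rightarrow> nat" where "ltl c = nsnd (c - 1)"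
definition lcons :: "nat \<Rightarrow> nat \<Rightarrow> nat" where "lcons x c = Suc (prod_encode (x, c))"
definition lnth :: "nat \<Rightarrow> nat \<Rightarrow> nat" where "lnth c i = lhd ((ltl ^^ i) c)"
definition llen :: "nat \<Rightarrow> nat" where "llen c = (LEAST i. (ltl ^^ i) c = 0)"

lemma lcons_list_encode [simp]: "lcons x (list_encode xs) = list_encode (x # xs)"
  by (simp add: lcons_def)

lemma lhd_list_encode [simp]: "lhd (list_encode (x # xs)) = x"
  by (simp add: lhd_def)

lemma prod_decode_0: "prod_decode 0 = (0, 0)"
  using prod_encode_inverse[of "(0, 0)"] by (simp add: prod_encode_def)

lemma ltl_list_encode [simp]: "ltl (list_encode xs) = list_encode (tl xs)"
  by (cases xs) (simp_all add: ltl_def nsnd_def prod_decode_0)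

lemma list_encode_eq_0_iff [simp]: "list_encode xs = 0 \<longleftrightarrow> xs = []"
  by (cases xs) simp_all

lemma list_encode_gt_0_iff [simp]: "0 < list_encode xs \<longleftrightarrow> xs \<noteq> []"
  by (cases xs) simp_all

lemma funpow_ltl_list_encode: "(ltl ^^ i) (list_encode xs) = list_encode (drop i xs)"
  by (induction i) (simp_all add: tl_drop drop_Suc del: list_encode.simps)

lemma lnth_list_encode: "i < length xs \<Longrightarrow> lnth (list_encode xs) i = xs ! i"
  by (simp add: lnth_def funpow_ltl_list_encode Cons_nth_drop_Suc[symmetric] del: list_encode.simps)

lemma llen_list_encode [simp]: "llen (list_encode xs) = length xs"
  unfolding llen_def by (rule Least_equality) (simp_all add: funpow_ltl_list_encode)

lemma computable_lhd: "computable_in A f \<Longrightarrow> computable_in A (\<lambda>x. lhd (f x))"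
  unfolding lhd_def by (intro computable_intros)

lemma computable_ltl: "computable_in A f \<Longrightarrow> computable_in A (\<lambda>x. ltl (f x))"
  unfolding ltl_def by (intro computable_intros)

lemma computable_lcons:
  "computable_in A f \<Longrightarrow> computable_in A g \<Longrightarrow> computable_in A (\<lambda>x. lcons (f x) (g x))"
  unfolding lcons_def by (intro computable_intros)

lemma computable_lnth:
  "computable_in A f \<Longrightarrow> computable_in A g \<Longrightarrow> computable_in A (\<lambda>x. lnth (f x) (g x))"
  unfolding lnth_def
  by (intro computable_lhd computable_funpow computable_ltl computable_id)

lemma computable_llen:
  assumes "computable_in A f"
  shows "computable_in A (\<lambda>x. llen (f x))"
proof -
  have ex: "\<exists>i. (ltl ^^ i) c = 0" for c
  proof -
    obtain xs where "c = list_encode xs" by (metis list_decode_inverse)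
    then show ?thesis by (auto simp: funpow_ltl_list_encode intro: exI[of _ "length xs"])
  qed
  show ?thesis
    unfolding llen_def
    by (intro computable_Least ex decidable_eq computable_funpow computable_ltl
        computable_comp[OF assms] computable_intros)
qed

section \<open>Evaluation facts as numbers and the rules that derive them\<close>

definition triple :: "nat \<Rightarrow> nat \<Rightarrow> nat \<Rightarrow> nat" where
  "triple c xs y = prod_encode (c, prod_encode (xs, y))"

lemma computable_triple:
  "computable_in A f \<Longrightarrow> computable_in A g \<Longrightarrow> computable_in A h
    \<Longrightarrow> computable_in A (\<lambda>x. triple (f x) (g x) (h x))"
  unfolding triple_def by (intro computable_intros)

text \<open>A set bit at position \<open>n\<close> makes the code at least \<open>2 ^ n\<close>,
  which exceeds \<open>n\<close>. This is where the bounds on the quantifiers in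
  \<open>justified\<close> come from.\<close>

lemma mem_set_decode_less: "n \<in> set_decode d \<Longrightarrow> n < d"
proof -
  assume "n \<in> set_decode d"
  then have "d div 2 ^ n \<noteq> 0" by (auto simp: set_decode_def intro: ccontr)
  then have "2 ^ n \<le> d" by (metis div_less not_less)
  then show "n < d" by (rule less_le_trans[OF less_exp])
qed

lemma mem_set_decode_triple_less:
  assumes "triple c xs y \<in> set_decode d"
  shows "xs < d" and "y < d"
  using mem_set_decode_less[OF assms] le_prod_encode_1[of xs y] le_prod_encode_2[of y xs]
    le_prod_encode_2[of "prod_encode (xs, y)" c] unfolding triple_def by linarith+

text \<open>\<open>justified A d c xs y\<close>: the triple follows by one rule of \<^const>\<open>evaluates\<close> from triples in
  the finite set coded by \<open>d\<close>. The bounds by \<open>d\<close> are harmless and keep the predicate decidable.\<close>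

definition justified :: "nat set \<Rightarrow> nat \<Rightarrow> nat \<Rightarrow> nat \<Rightarrow> nat \<Rightarrow> bool" where
  "justified A d c xs y \<longleftrightarrow>
    nfst c = 0 \<and> y = 0 \<or>
    nfst c = 1 \<and> xs = lcons (lhd xs) 0 \<and> y = Suc (lhd xs) \<or>
    nfst c = 2 \<and> xs = lcons (lhd xs) 0 \<and> y = (if lhd xs \<in> A then 1 else 0) \<or>
    nfst c = 3 \<and> nsnd c < llen xs \<and> y = lnth xs (nsnd c) \<or>
    nfst c = 4 \<and> (\<exists>ys<d. llen ys = llen (nsnd (nsnd c)) \<and>
      (\<forall>i<llen ys. triple (lnth (nsnd (nsnd c)) i) xs (lnth ys i) \<in> set_decode d) \<and>
      triple (nfst (nsnd c)) ys y \<in> set_decode d) \<or>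
    nfst c = 5 \<and> 0 < xs \<and> lhd xs = 0 \<and>
      triple (nfst (nsnd c)) (ltl xs) y \<in> set_decode d \<or>
    nfst c = 5 \<and> 0 < xs \<and> 0 < lhd xs \<and>
      (\<exists>r<d. triple c (lcons (lhd xs - 1) (ltl xs)) r \<in> set_decode d \<and>
        triple (nsnd (nsnd c)) (lcons (lhd xs - 1) (lcons r (ltl xs))) y \<in> set_decode d) \<or>
    nfst c = 6 \<and> triple (nsnd c) (lcons y xs) 0 \<in> set_decode d \<and>
      (\<forall>m<y. \<exists>v<d. 0 < v \<and> triple (nsnd c) (lcons m xs) v \<in> set_decode d)"

lemma decidable_justified:
  assumes "computable_in A d" and "computable_in A c" and "computable_in A xs"
    and "computable_in A y"
  shows "decidable_in A (\<lambda>x. justified A (d x) (c x) (xs x) (y x))"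
  unfolding justified_def
  by (intro computable_intros decidable_mem_set_decode computable_triple computable_lhd
      computable_ltl computable_lcons computable_lnth computable_llen
      assms assms[THEN computable_comp])

text \<open>The tag \<open>nfst c\<close> identifies the outermost constructor of \<open>p\<close>,
  so only the disjuncts for that constructor survive, and they supply the premises of the matching
  rule.\<close>

lemma justified_sound:
  assumes sound: "\<And>q zs z. triple (code q) (list_encode zs) z \<in> set_decode d
      \<Longrightarrow> evaluates A q zs z"
    and "justified A d (code p) (list_encode xs) y"
  shows "evaluates A p xs y"
proof (cases p)
  case Zero
  then show ?thesis using assms(2) by (simp add: justified_def evaluates.zero)
next
  case Succ
  \<comment> \<open>A code of the form \<open>lcons z 0\<close> stands for a one-element list, so
    the equation in \<open>justified\<close> says that the input has length one.\<close>
  with assms(2) have "list_encode xs = list_encode [lhd (list_encode xs)]"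
    and y: "y = Suc (lhd (list_encode xs))"
    by (simp_all add: justified_def lcons_def)
  then have "xs = [lhd (list_encode xs)]" unfolding list_encode_eq by blast
  then show ?thesis using Succ y by (metis evaluates.succ)
next
  case Query
  with assms(2) have "list_encode xs = list_encode [lhd (list_encode xs)]"
    and y: "y = (if lhd (list_encode xs) \<in> A then 1 else 0)"
    by (simp_all add: justified_def lcons_def)
  then have "xs = [lhd (list_encode xs)]" unfolding list_encode_eq by blast
  then show ?thesis using Query y evaluates.query[of A "lhd (list_encode xs)"] by simp
next
  case (Proj i)
  then show ?thesis using assms(2) by (auto simp: justified_def lnth_list_encode evaluates.proj)
next
  case (Comp f gs)
  then obtain c where c: "llen c = length gs"
      "\<forall>i<llen c. triple (lnth (list_encode (map code gs)) i) (list_encode xs) (lnth c i)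
        \<in> set_decode d"
      "triple (code f) c y \<in> set_decode d"
    using assms(2) by (auto simp: justified_def)
  obtain ys where ys: "c = list_encode ys" by (metis list_decode_inverse)
  from c(3) have "evaluates A f ys y" unfolding ys by (rule sound)
  moreover have "list_all2 (\<lambda>g y. evaluates A g xs y) gs ys"
    unfolding list_all2_conv_all_nth
  proof (intro conjI allI impI)
    fix i assume "i < length gs"
    then show "evaluates A (gs ! i) xs (ys ! i)"
      using c(1,2) by (auto simp: ys lnth_list_encode intro!: sound)
  qed (use c(1) ys in simp)
  ultimately show ?thesis unfolding Comp by (blast intro: evaluates.comp)
next
  case (PrimRec f g)
  show ?thesis
  proof (cases xs)
    case Nil
    then show ?thesis using assms(2) PrimRec by (simp add: justified_def)
  next
    case (Cons n zs)
    show ?thesis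
    proof (cases n)
      case 0
      with assms(2) Cons PrimRec have "triple (code f) (list_encode zs) y \<in> set_decode d"
        by (simp add: justified_def del: list_encode.simps)
      from sound[OF this] show ?thesis unfolding Cons PrimRec 0 by (rule evaluates.prim_zero)
    next
      case (Suc k)
      with assms(2) Cons PrimRec obtain r
        where "triple (code p) (list_encode (k # zs)) r \<in> set_decode d"
          and "triple (code g) (list_encode (k # r # zs)) y \<in> set_decode d"
        by (auto simp: justified_def simp del: list_encode.simps)
      from this[THEN sound] show ?thesis
        unfolding Cons PrimRec Suc by (rule evaluates.prim_Suc)
    qed
  qed
next
  case (Mu f)
  with assms(2) have 0: "triple (code f) (list_encode (y # xs)) 0 \<in> set_decode d"
    and pos: "\<forall>m<y. \<exists>v>0. triple (code f) (list_encode (m # xs)) v \<in> set_decode d"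
    by (auto simp: justified_def simp del: list_encode.simps)
  show ?thesis
    unfolding Mu by (rule evaluates.mu) (use 0 pos sound in blast)+
qed

text \<open>The cutoff at \<open>s\<close> keeps each stage finite and hence codable by a number. A
  given evaluation is expected not at one particular stage but at all sufficiently late
  ones.\<close>

primrec stage :: "nat set \<Rightarrow> nat \<Rightarrow> nat" where
  "stage A 0 = 0"
| "stage A (Suc s) =
    set_encode {t. t < s \<and> justified A (stage A s) (nfst t) (nfst (nsnd t)) (nsnd (nsnd t))}"

lemma mem_stage_Suc:
  "triple c xs y \<in> set_decode (stage A (Suc s)) \<longleftrightarrow>
    triple c xs y < s \<and> justified A (stage A s) c xs y"
  by (simp add: set_encode_inverse) (simp add: triple_def)

lemma computable_stage:
  assumes "computable_in A f"
  shows "computable_in A (\<lambda>x. stage A (f x))"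
proof -
  have "stage A s = rec_nat 0 (\<lambda>s d.
      set_encode {t. t < s \<and> justified A d (nfst t) (nfst (nsnd t)) (nsnd (nsnd t))}) s" for s
    by (induction s) simp_all
  then show ?thesis
    by (simp only:) (intro computable_rec assms computable_set_encode decidable_justified
        computable_intros)
qed

lemma stage_sound:
  "triple (code p) (list_encode xs) y \<in> set_decode (stage A s) \<Longrightarrow> evaluates A p xs y"
proof (induction s arbitrary: p xs y)
  case 0
  then show ?case by simp
next
  case (Suc s)
  then show ?case unfolding mem_stage_Suc by (blast intro: justified_sound)
qed

text \<open>Once \<open>s\<close> exceeds the code of the triple, the cutoff in \<open>stage\<close>
  no longer excludes it, and a shift of the index by one does not affect statements about all late
  stages.\<close>

lemma stage_step:
  assumes "\<forall>\<^sub>F s in sequentially. justified A (stage A s) c xs y"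
  shows "\<forall>\<^sub>F s in sequentially. triple c xs y \<in> set_decode (stage A s)"
proof -
  have "\<forall>\<^sub>F s in sequentially. triple c xs y \<in> set_decode (stage A (Suc s))"
    unfolding mem_stage_Suc using assms eventually_gt_at_top by (rule eventually_conj[rotated])
  then show ?thesis by (rule eventually_sequentially_Suc[THEN iffD1])
qed

text \<open>Each rule instance has finitely many premises, also for the argument list of a
  composition and the values below \<open>n\<close> in a minimisation. So from some stage on all of
  them are present together.\<close>

lemma stage_complete:
  "evaluates A p xs y \<Longrightarrow>
    \<forall>\<^sub>F s in sequentially. triple (code p) (list_encode xs) y \<in> set_decode (stage A s)"
proof (induction rule: evaluates.induct)
  case (zero xs)
  show ?case by (rule stage_step) (simp add: justified_def)
next
  case (succ x)
  show ?case
    by (rule stage_step) (simp add: justified_def lcons_def lhd_def)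
next
  case (query x)
  show ?case
    by (rule stage_step) (simp add: justified_def lcons_def lhd_def)
next
  case (proj i xs)
  then show ?case by (intro stage_step) (simp add: justified_def lnth_list_encode)
next
  case (comp xs gs ys f z)
  have len: "length gs = length ys" using comp.IH(1) by (rule list_all2_lengthD)
  have "\<forall>\<^sub>F s in sequentially. \<forall>i\<in>{..<length ys}.
      triple (code (gs ! i)) (list_encode xs) (ys ! i) \<in> set_decode (stage A s)"
    using comp.IH(1) len
    by (intro eventually_ball_finite finite_lessThan ballI) (simp add: list_all2_conv_all_nth)
  with comp.IH(2) have "\<forall>\<^sub>F s in sequentially.
      justified A (stage A s) (code (Comp f gs)) (list_encode xs) z"
  proof eventually_elim
    case (elim s)
    \<comment> \<open>The bound on the code of the intermediate results holds because the triple for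
      \<open>f\<close> has them as its input.\<close>
    have "\<exists>c<stage A s. llen c = llen (list_encode (map code gs)) \<and>
      (\<forall>i<llen c. triple (lnth (list_encode (map code gs)) i) (list_encode xs) (lnth c i)
        \<in> set_decode (stage A s)) \<and> triple (code f) c z \<in> set_decode (stage A s)"
      using elim len mem_set_decode_triple_less(1)[OF elim(1)]
      by (intro exI[of _ "list_encode ys"]) (simp add: lnth_list_encode)
    then show ?case unfolding justified_def code.simps nfst_prod_encode nsnd_prod_encode by simp
  qed
  then show ?case by (rule stage_step)
next
  case (prim_zero f xs y g)
  from prim_zero.IH show ?case
    by (intro stage_step, rule eventually_mono) (simp add: justified_def del: list_encode.simps)
next
  case (prim_Suc f g n xs r y)
  from prim_Suc.IH have "\<forall>\<^sub>F s in sequentially.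
      justified A (stage A s) (code (PrimRec f g)) (list_encode (Suc n # xs)) y"
  proof eventually_elim
    case (elim s)
    with mem_set_decode_triple_less(2)[OF elim(1)]
    have "\<exists>r<stage A s.
        triple (code (PrimRec f g)) (list_encode (n # xs)) r \<in> set_decode (stage A s) \<and>
        triple (code g) (list_encode (n # r # xs)) y \<in> set_decode (stage A s)"
      by blast
    then show ?case by (simp add: justified_def del: list_encode.simps)
  qed
  then show ?case by (rule stage_step)
next
  case (mu f n xs)
  have "\<forall>\<^sub>F s in sequentially. \<forall>m\<in>{..<n}. \<exists>v>0.
      triple (code f) (list_encode (m # xs)) v \<in> set_decode (stage A s)"
  proof (intro eventually_ball_finite finite_lessThan ballI)
    fix m assume "m \<in> {..<n}"
    then have "m < n" by simp
    from mu.IH(2)[OF this] obtain v where pos: "0 < v" and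
      ev: "\<forall>\<^sub>F s in sequentially.
        triple (code f) (list_encode (m # xs)) v \<in> set_decode (stage A s)"
      by (elim exE conjE)
    from ev show "\<forall>\<^sub>F s in sequentially. \<exists>v>0.
        triple (code f) (list_encode (m # xs)) v \<in> set_decode (stage A s)"
      by (rule eventually_mono) (use pos in blast)
  qed
  with mu.IH(1) have "\<forall>\<^sub>F s in sequentially.
      justified A (stage A s) (code (Mu f)) (list_encode xs) n"
  proof eventually_elim
    case (elim s)
    have "\<forall>m<n. \<exists>v<stage A s. 0 < v \<and>
        triple (code f) (list_encode (m # xs)) v \<in> set_decode (stage A s)"
    proof (intro allI impI)
      fix m assume "m < n"
      with elim(2) obtain v where "0 < v"
        and v: "triple (code f) (list_encode (m # xs)) v \<in> set_decode (stage A s)"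
        by blast
      with mem_set_decode_triple_less(2)[OF v] show "\<exists>v<stage A s. 0 < v \<and>
          triple (code f) (list_encode (m # xs)) v \<in> set_decode (stage A s)"
        by blast
    qed
    with elim(1) show ?case by (simp add: justified_def del: list_encode.simps)
  qed
  then show ?case by (rule stage_step)
qed

section \<open>The Turing jump and limits\<close>

primrec replace_query :: "prog \<Rightarrow> prog \<Rightarrow> prog" where
  "replace_query q Zero = Zero"
| "replace_query q Succ = Succ"
| "replace_query q Query = q"
| "replace_query q (Proj i) = Proj i"
| "replace_query q (Comp f gs) = Comp (replace_query q f) (map (replace_query q) gs)"
| "replace_query q (PrimRec f g) = PrimRec (replace_query q f) (replace_query q g)"
| "replace_query q (Mu f) = Mu (replace_query q f)"

lemma evaluates_replace_query:
  assumes q: "\<And>n. evaluates B q [n] (if n \<in> A then 1 else 0)"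
  shows "evaluates A p xs y \<Longrightarrow> evaluates B (replace_query q p) xs y"
proof (induction rule: evaluates.induct)
  case (comp xs gs ys f z)
  then show ?case by (auto intro!: evaluates.comp[where ys = ys] simp: list_all2_conv_all_nth)
next
  case (mu f n xs)
  then show ?case by (auto intro!: evaluates.mu)
qed (use q in \<open>auto intro: evaluates.intros\<close>)

lemma computable_in_trans:
  assumes "computable_set_in B A" and "computable_in A f"
  shows "computable_in B f"
  using assms evaluates_replace_query unfolding computable_set_in_def computable_in_def by metis

section \<open>Hardwired inputs and the limit lemma\<close>

primrec const_prog :: "nat \<Rightarrow> prog" where
  "const_prog 0 = Zero"
| "const_prog (Suc n) = Comp Succ [const_prog n]"

lemma evaluates_const_prog: "evaluates A (const_prog n) xs n"
  by (induction n) (auto intro: evaluates.zero evaluates.succ evaluates_Comp1)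

text \<open>The code is itself obtained by recursion on the number: each step wraps the previous
  code in a composition with \<open>Succ\<close>, and \<open>Suc (prod_encode (r, 0))\<close> codes
  the one-element argument list.\<close>

lemma computable_code_const_prog:
  assumes "computable_in A f"
  shows "computable_in A (\<lambda>x. code (const_prog (f x)))"
proof -
  have "code (const_prog n) = rec_nat (code Zero)
      (\<lambda>_ r. prod_encode (4, prod_encode (code Succ, Suc (prod_encode (r, 0))))) n" for n
    by (induction n) simp_all
  then show ?thesis by (simp only:) (intro computable_rec computable_intros assms)
qed

text \<open>A search over \<open>i\<close> with \<open>x\<close> hardwired ignores its input, so the diagonal halting problem
  decides whether it succeeds; the code of that program depends computably on \<open>x\<close>.\<close>

lemma decidable_jump_ex:
  assumes "decidable_in A (\<lambda>z. P (nfst z) (nsnd z))"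
  shows "decidable_in (turing_jump A) (\<lambda>x. \<exists>i. P x i)"
proof -
  have "computable_in A (\<lambda>z. if \<not> P (nfst z) (nsnd z) then 1 else 0)"
    using decidable_not[OF assms] unfolding decidable_in_def .
  then have "uniformly_computable_in A (\<lambda>x i. if \<not> P x i then 1 else 0)"
    by (simp add: uniformly_computable_iff)
  from uniformly_computable_comp2[OF this uniformly_computable_snd uniformly_computable_fst]
  obtain p where p: "evaluates A p [i, x] (if \<not> P x i then 1 else 0)" for i x
    unfolding uniformly_computable_in_def by blast
  define q where "q x = Comp (Mu p) [const_prog x]" for x
  have halts: "(\<exists>y. evaluates A (q x) xs y) \<longleftrightarrow> (\<exists>i. P x i)" for x xs
  proof
    assume "\<exists>y. evaluates A (q x) xs y"
    then obtain y zs where "list_all2 (\<lambda>g. evaluates A g xs) [const_prog x] zs"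
      and Mu: "evaluates A (Mu p) zs y"
      unfolding q_def by (blast elim: evaluates_CompE)
    then obtain z where "zs = [z]" "evaluates A (const_prog x) xs z"
      by (auto simp: list_all2_Cons1)
    with evaluates_deterministic[OF evaluates_const_prog this(2)] have "zs = [x]" by simp
    with Mu have "evaluates A p [y, x] 0" by (blast elim: evaluates_MuE)
    from evaluates_deterministic[OF this p] have "P x y" by (simp split: if_splits)
    then show "\<exists>i. P x i" ..
  next
    assume "\<exists>i. P x i"
    then have least: "P x (LEAST i. P x i)" by (rule LeastI_ex)
    have "evaluates A (Mu p) [x] (LEAST i. P x i)"
    proof (rule evaluates.mu)
      show "evaluates A p [LEAST i. P x i, x] 0"
        using p[of "LEAST i. P x i" x] least by simp
      fix m assume "m < (LEAST i. P x i)"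
      then have "\<not> P x m" by (rule not_less_Least)
      then have "evaluates A p [m, x] 1" using p[of m x] by simp
      then show "\<exists>y>0. evaluates A p [m, x] y" using zero_less_one by blast
    qed
    then show "\<exists>y. evaluates A (q x) xs y"
      unfolding q_def using evaluates_Comp1[OF evaluates_const_prog] by blast
  qed
  \<comment> \<open>By injectivity of \<open>code\<close>, only \<open>q x\<close> has this code. It
    halts on all inputs or on none, so halting on its own code amounts to success of the
    search.\<close>
  have "code (q x) \<in> turing_jump A \<longleftrightarrow> (\<exists>y. evaluates A (q x) [code (q x)] y)" for x
    unfolding turing_jump_def using code_inject by blast
  then have "(\<exists>i. P x i) \<longleftrightarrow> code (q x) \<in> turing_jump A" for x
    by (simp add: halts)
  moreover have "decidable_in (turing_jump A) (\<lambda>x. code (q x) \<in> turing_jump A)"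
    unfolding q_def code.simps list.map list_encode.simps
    by (intro computable_intros computable_code_const_prog)
  ultimately show ?thesis by (simp only:)
qed

text \<open>Membership in \<open>A\<close> is decidable in \<open>A\<close>, hence is an existential
  condition with a dummy variable, and the jump decides those.\<close>

lemma computable_set_in_turing_jump: "computable_set_in (turing_jump A) A"
  using decidable_jump_ex[where P = "\<lambda>x i. x \<in> A",
      OF decidable_oracle[OF computable_nfst_id]]
  by (simp add: computable_set_in_def decidable_in_def)

text \<open>One direction of the limit lemma. That the approximation still departs from its value at
  stage \<open>s\<close> is an existential condition, so the jump can search for a stage where this
  fails; the value there is the limit.\<close>

lemma limit_computable_imp_computable_turing_jump:
  assumes "limit_computable_in A f"
  shows "computable_in (turing_jump A) f"
proof -
  obtain g where g: "computable_in A (\<lambda>z. g (nfst z) (nsnd z))"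
    and lim: "\<And>n. (\<lambda>s. g s n) \<longlonglongrightarrow> f n"
    using assms unfolding limit_computable_in_def uniformly_computable_iff by blast
  define unstable where "unstable n s \<longleftrightarrow> (\<exists>t. s \<le> t \<and> g t n \<noteq> g s n)" for n s
  have ev: "\<forall>\<^sub>F s in sequentially. g s n = f n" for n
    using lim[of n] by (simp add: tendsto_discrete)
  have ex: "\<exists>s. \<not> unstable n s" for n
  proof -
    obtain N where "\<And>s. N \<le> s \<Longrightarrow> g s n = f n"
      using ev[of n] unfolding eventually_sequentially by blast
    then have "\<not> unstable n N" by (simp add: unstable_def)
    then show ?thesis ..
  qed
  have stable: "g s n = f n" if "\<not> unstable n s" for n s
  proof -
    obtain N where N: "\<And>s. N \<le> s \<Longrightarrow> g s n = f n"
      using ev[of n] unfolding eventually_sequentially by blast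
    have "g (max s N) n = g s n"
      using that max.cobounded1[of s N] unfolding unstable_def by blast
    with N[of "max s N"] show ?thesis by simp
  qed
  have g_comp: "computable_in A (\<lambda>x. g (u x) (v x))"
    if "computable_in A u" and "computable_in A v" for u v
    using computable_comp[OF g computable_prod_encode[OF that]] by simp
  have "decidable_in (turing_jump A) (\<lambda>z. unstable (nfst z) (nsnd z))"
    unfolding unstable_def by (intro decidable_jump_ex computable_intros g_comp)
  then have "computable_in (turing_jump A) (\<lambda>n. LEAST s. \<not> unstable n s)"
    by (intro computable_Least decidable_not ex)
  from computable_comp[OF computable_in_trans[OF computable_set_in_turing_jump g]
      computable_prod_encode[OF this computable_id]]
  have "computable_in (turing_jump A) (\<lambda>n. g (LEAST s. \<not> unstable n s) n)" by simp
  moreover have "g (LEAST s. \<not> unstable n s) n = f n" for n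
    by (rule stable) (rule LeastI_ex[OF ex])
  ultimately show ?thesis by simp
qed

section \<open>The construction\<close>

text \<open>A digit not yet known to be 1 is read as 0, and \<open>lcons m 0\<close> codes the input
  \<open>[m]\<close>. The prefix is kept as an integer so that witnesses are tested by integer
  arithmetic.\<close>

primrec digits :: "nat set \<Rightarrow> nat \<Rightarrow> nat \<Rightarrow> nat \<Rightarrow> nat" where
  "digits A c s 0 = 0"
| "digits A c s (Suc m) = 2 * digits A c s m +
    (if triple c (lcons m 0) 1 \<in> set_decode (stage A s) then 1 else 0)"

text \<open>\<open>w = (q, m, s)\<close> is a witness for the product \<open>p\<close> and the program code \<open>c\<close> if the first \<open>m\<close>
  binary digits of the real \<open>x\<close> computed by \<open>c\<close> are known at stage \<open>s\<close> and already imply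
  \<open>frac (q * p * x) \<le> 2 / 3\<close>.\<close>

definition witness :: "nat set \<Rightarrow> nat \<Rightarrow> nat \<Rightarrow> nat \<Rightarrow> bool" where
  "witness A p c w \<longleftrightarrow> 2 \<le> nfst w \<and>
    (\<forall>i<nfst (nsnd w). \<exists>v<2.
      triple c (lcons i 0) v \<in> set_decode (stage A (nsnd (nsnd w)))) \<and>
    3 * ((nfst w * p * digits A c (nsnd (nsnd w)) (nfst (nsnd w))) mod 2 ^ nfst (nsnd w)
      + nfst w * p) \<le> 2 * 2 ^ nfst (nsnd w)"

lemma witness_ge_2: "witness A p c w \<Longrightarrow> 2 \<le> nfst w"
  by (simp add: witness_def)

lemma decidable_witness:
  assumes "computable_in A p" and "computable_in A c" and "computable_in A w"
  shows "decidable_in A (\<lambda>x. witness A (p x) (c x) (w x))"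
proof -
  have "digits A c s m = rec_nat 0 (\<lambda>i r. 2 * r +
    (if triple c (lcons i 0) 1 \<in> set_decode (stage A s) then 1 else 0)) m" for c s m
    by (induction m) simp_all
  then have digits: "computable_in A (\<lambda>x. digits A (c x) (s x) (m x))"
    if "computable_in A s" and "computable_in A m" for s m
    by (simp only:) (intro computable_rec computable_intros decidable_mem_set_decode
        computable_triple computable_lcons computable_stage
        that that[THEN computable_comp] assms assms[THEN computable_comp])
  then show ?thesis
    unfolding witness_def
    by (intro computable_intros digits decidable_mem_set_decode computable_triple
        computable_lcons computable_stage assms assms[THEN computable_comp])
qed

text \<open>On the block \<open>{4 ^ j..<4 ^ (j + 1)}\<close> the least exponent is
  \<open>Suc j\<close>. Read as a pair, its first component names the program, while the free second
  component gives every program infinitely many blocks.\<close>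

definition schedule :: "nat \<Rightarrow> nat" where
  "schedule n = nfst (LEAST j. n < 4 ^ j)"

lemma computable_schedule: "computable_in A f \<Longrightarrow> computable_in A (\<lambda>x. schedule (f x))"
proof -
  assume f: "computable_in A f"
  have "n < 4 ^ n" for n :: nat by (induction n) auto
  then have "computable_in A (\<lambda>n. LEAST j. n < 4 ^ j)"
    by (intro computable_Least computable_intros) blast
  from computable_comp[OF computable_nfst[OF this] f] show ?thesis unfolding schedule_def .
qed

lemma schedule_eq:
  assumes "4 ^ j \<le> n" and "n < 4 ^ Suc j"
  shows "schedule n = nfst (Suc j)"
proof -
  have "(LEAST i. n < 4 ^ i) = Suc j"
  proof (rule Least_equality)
    fix i assume "n < 4 ^ i"
    with assms(1) have "(4::nat) ^ j < 4 ^ i" by (rule le_less_trans)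
    then show "Suc j \<le> i" using power_less_imp_less_exp[of "4::nat" j i] by simp
  qed (rule assms(2))
  then show ?thesis by (simp add: schedule_def)
qed

text \<open>The cap \<open>s\<close> makes the search total, and the test asks whether it ended at a
  genuine witness. The default 2 is shared with \<open>factor\<close>, so the two agree at every
  \<open>s\<close> if there is no witness.\<close>

definition factor_approx :: "nat set \<Rightarrow> nat \<Rightarrow> nat \<Rightarrow> nat \<Rightarrow> nat" where
  "factor_approx A s p n =
    (if witness A p (schedule n) (LEAST w. s \<le> w \<or> witness A p (schedule n) w)
     then nfst (LEAST w. s \<le> w \<or> witness A p (schedule n) w) else 2)"

definition factor :: "nat set \<Rightarrow> nat \<Rightarrow> nat \<Rightarrow> nat" where
  "factor A p n =
    (if \<exists>w. witness A p (schedule n) w then nfst (LEAST w. witness A p (schedule n) w) else 2)"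

primrec base_product_approx :: "nat set \<Rightarrow> nat \<Rightarrow> nat \<Rightarrow> nat" where
  "base_product_approx A s 0 = 1"
| "base_product_approx A s (Suc n) =
    base_product_approx A s n * factor_approx A s (base_product_approx A s n) n"

primrec base_product :: "nat set \<Rightarrow> nat \<Rightarrow> nat" where
  "base_product A 0 = 1"
| "base_product A (Suc n) = base_product A n * factor A (base_product A n) n"

definition base :: "nat set \<Rightarrow> nat \<Rightarrow> nat" where
  "base A n = factor A (base_product A n) n"

lemma base_product_eq: "base_product A n = (\<Prod>i<n. base A i)"
  by (induction n) (simp_all add: base_def)

lemma factor_ge_2: "2 \<le> factor A p n"
  using LeastI_ex[of "witness A p (schedule n)"] witness_ge_2 by (auto simp: factor_def)

lemma eventually_factor_approx:
  "\<forall>\<^sub>F s in sequentially. factor_approx A s p n = factor A p n"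
proof (cases "\<exists>w. witness A p (schedule n) w")
  case True
  define v where "v = (LEAST w. witness A p (schedule n) w)"
  have v: "witness A p (schedule n) v" unfolding v_def using True by (rule LeastI_ex)
  have "\<forall>\<^sub>F s in sequentially. v < s" by (rule eventually_gt_at_top)
  then show ?thesis
  proof eventually_elim
    case (elim s)
    have "(LEAST w. s \<le> w \<or> witness A p (schedule n) w) = v"
    proof (rule Least_equality)
      fix w assume "s \<le> w \<or> witness A p (schedule n) w"
      then show "v \<le> w" using elim by (auto simp: v_def intro: Least_le)
    qed (simp add: v)
    then show ?case using True v by (simp add: factor_approx_def factor_def v_def)
  qed
next
  case False
  then show ?thesis by (simp add: factor_approx_def factor_def)
qed

text \<open>At late stages the product of the earlier terms is already correct, so the next search
  runs with the right parameter and in turn settles.\<close>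

lemma eventually_base_product_approx:
  "\<forall>\<^sub>F s in sequentially. base_product_approx A s n = base_product A n"
proof (induction n)
  case (Suc n)
  with eventually_factor_approx[of A "base_product A n" n] show ?case
    by eventually_elim simp
qed simp

lemma limit_computable_base: "limit_computable_in A (base A)"
proof -
  define g where "g s n = factor_approx A s (base_product_approx A s n) n" for s n
  have factor: "computable_in A (\<lambda>x. factor_approx A (s x) (p x) (n x))"
    if "computable_in A s" and "computable_in A p" and "computable_in A n" for s p n
    unfolding factor_approx_def
    by (intro computable_intros computable_Least decidable_witness computable_schedule
        that that[THEN computable_comp]) auto
  have "base_product_approx A s n = rec_nat 1 (\<lambda>n p. p * factor_approx A s p n) n" for s n
    by (induction n) simp_all
  then have product: "computable_in A (\<lambda>x. base_product_approx A (s x) (n x))"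
    if "computable_in A s" and "computable_in A n" for s n
    by (simp only:) (intro computable_rec computable_intros factor
        that that[THEN computable_comp])
  then have "uniformly_computable_in A g"
    unfolding g_def uniformly_computable_iff by (intro factor product computable_intros)
  moreover have "(\<lambda>s. g s n) \<longlonglongrightarrow> base A n" for n
  proof (rule tendsto_eventually)
    from eventually_base_product_approx[of A n] eventually_factor_approx[of A "base_product A n" n]
    show "\<forall>\<^sub>F s in sequentially. g s n = base A n"
      by eventually_elim (simp add: g_def base_def)
  qed
  ultimately show ?thesis unfolding limit_computable_in_def by blast
qed

section \<open>Orbits of computable reals\<close>

lemma frac_of_int_mult: "frac (of_int k * x) = frac (of_int k * frac (x :: real))"
proof -
  have "of_int k * x = of_int k * frac x + of_int (k * \<lfloor>x\<rfloor>)"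
    by (simp add: frac_def algebra_simps)
  then show ?thesis by (simp add: frac_def)
qed

lemma frac_eqI: "0 \<le> f \<Longrightarrow> f < 1 \<Longrightarrow> y = of_int k + f \<Longrightarrow> frac y = (f :: real)"
  by (simp add: frac_def floor_add_int floor_unique)

text \<open>Multiples of \<open>y\<close> modulo 1 advance by \<open>f\<close> or retreat by
  \<open>1 - f\<close>, whichever is at most 1/2, so they cannot jump over the lower half of the
  circle. Strict positivity leaves room for a numerical certificate.\<close>

lemma exists_multiplier:
  fixes y :: real
  assumes "frac y \<noteq> 0"
  shows "\<exists>q::nat. 2 \<le> q \<and> 0 < frac (real q * y) \<and> frac (real q * y) \<le> 1 / 2"
proof -
  define f where "f = frac y"
  have f: "0 < f" "f < 1"
    using assms frac_ge_0[of y] frac_lt_1[of y] unfolding f_def by linarith+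
  have eq: "frac (real q * y) = frac (real q * f)" for q
    using frac_of_int_mult[of "int q" y] by (simp add: f_def)
  show ?thesis
  proof (cases "f \<le> 1 / 2")
    case True
    \<comment> \<open>This is the first multiplier with \<open>q * f > 1\<close>, so
      \<open>q * f\<close> overshoots 1 by at most \<open>f\<close>.\<close>
    define q where "q = nat (\<lfloor>1 / f\<rfloor> + 1)"
    have pos: "0 \<le> \<lfloor>1 / f\<rfloor>" using f by simp
    then have q: "real q = of_int \<lfloor>1 / f\<rfloor> + 1" by (simp add: q_def)
    have "1 / f < real q" and "real q - 1 \<le> 1 / f" unfolding q by linarith+
    then have less: "1 < real q * f" and "(real q - 1) * f \<le> 1"
      using f by (simp_all add: field_simps)
    then have le: "real q * f \<le> 1 + f" by (simp add: algebra_simps)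
    have "2 \<le> q"
    proof (rule ccontr)
      assume "\<not> 2 \<le> q"
      then have "real q \<le> 1" by simp
      then have "real q * f \<le> 1 * f" using f by (intro mult_right_mono) simp_all
      with less f show False by simp
    qed
    moreover have "frac (real q * f) = real q * f - 1"
      by (rule frac_eqI[where k = 1]) (use less le True in simp_all)
    ultimately show ?thesis
      using less le True by (intro exI[of _ q]) (simp add: eq)
  next
    case False
    define g where "g = 1 - f"
    have g: "0 < g" "g < 1 / 2" using f False by (simp_all add: g_def)
    \<comment> \<open>This is the first multiplier with \<open>q * g >= 1 / 2\<close>; a step is
      shorter than 1/2, so \<open>q * g\<close> stays below 1. As \<open>1 / (2 * g)\<close> exceeds
      1, \<open>q\<close> is at least 2.\<close>
    define q where "q = nat \<lceil>1 / (2 * g)\<rceil>"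
    have "1 < 1 / (2 * g)" using g by (simp add: field_simps)
    then have q: "real q = of_int \<lceil>1 / (2 * g)\<rceil>" and "2 \<le> q" unfolding q_def by linarith+
    have "1 / (2 * g) \<le> real q" and "real q - 1 < 1 / (2 * g)" unfolding q by linarith+
    then have "1 / 2 \<le> real q * g" and "(real q - 1) * g < 1 / 2"
      using g by (simp_all add: field_simps)
    moreover from this have "real q * g < 1" using g by (simp add: algebra_simps)
    moreover have "real q * f = of_int (int q - 1) + (1 - real q * g)"
      by (simp add: g_def algebra_simps)
    ultimately have "frac (real q * f) = 1 - real q * g"
      by (intro frac_eqI[where k = "int q - 1"]) simp_all
    then show ?thesis
      using \<open>2 \<le> q\<close> \<open>1 / 2 \<le> real q * g\<close> \<open>real q * g < 1\<close>
      by (intro exI[of _ q]) (simp add: eq)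
  qed
qed

section \<open>Binary prefixes and their certification by stages\<close>

primrec binary_prefix :: "(nat \<Rightarrow> nat) \<Rightarrow> nat \<Rightarrow> nat" where
  "binary_prefix \<alpha> 0 = 0"
| "binary_prefix \<alpha> (Suc m) = 2 * binary_prefix \<alpha> m + \<alpha> m"

text \<open>The two bounds converge monotonically to \<open>x\<close>, from below and from above.
  The upper one is attained when all later digits are 1.\<close>

lemma binary_prefix_bounds:
  assumes bits: "\<And>n. \<alpha> n \<in> {0, 1}" and sums: "(\<lambda>n. real (\<alpha> n) / 2 ^ (n + 1)) sums x"
  shows "real (binary_prefix \<alpha> m) / 2 ^ m \<le> x" and "x \<le> (real (binary_prefix \<alpha> m) + 1) / 2 ^ m"
proof -
  have "(\<Sum>i<m. real (\<alpha> i) / 2 ^ (i + 1)) = real (binary_prefix \<alpha> m) / 2 ^ m" for m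
    by (induction m) (simp_all add: field_simps)
  then have lim: "(\<lambda>m. real (binary_prefix \<alpha> m) / 2 ^ m) \<longlonglongrightarrow> x"
    using sums by (simp add: sums_def)
  have "incseq (\<lambda>m. real (binary_prefix \<alpha> m) / 2 ^ m)"
    by (rule incseq_SucI) (simp add: field_simps)
  from incseq_le[OF this lim] show "real (binary_prefix \<alpha> m) / 2 ^ m \<le> x" .
  have "decseq (\<lambda>m. (real (binary_prefix \<alpha> m) + 1) / 2 ^ m)"
  proof (rule decseq_SucI)
    fix m show "(real (binary_prefix \<alpha> (Suc m)) + 1) / 2 ^ Suc m
        \<le> (real (binary_prefix \<alpha> m) + 1) / 2 ^ m"
      using bits[of m] by (auto simp: field_simps)
  qed
  moreover have "(\<lambda>m. (real (binary_prefix \<alpha> m) + 1) / 2 ^ m) \<longlonglongrightarrow> x"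
  proof -
    have "(\<lambda>m. (1 / 2) ^ m :: real) \<longlonglongrightarrow> 0" by (rule LIMSEQ_power_zero) simp
    from tendsto_add[OF lim this] show ?thesis
      by (simp add: add_divide_distrib power_one_over)
  qed
  ultimately show "x \<le> (real (binary_prefix \<alpha> m) + 1) / 2 ^ m" by (rule decseq_ge)
qed

text \<open>Soundness of the stages and determinism leave \<open>\<alpha> i\<close> as the only
  possible output, and the second assumption says that some output has been listed.\<close>

lemma stage_iff:
  assumes e: "\<And>n. evaluates A e [n] (\<alpha> n)"
    and "\<exists>v<2. triple (code e) (lcons i 0) v \<in> set_decode (stage A s)"
  shows "triple (code e) (lcons i 0) v \<in> set_decode (stage A s) \<longleftrightarrow> v = \<alpha> i"
proof -
  have "u = \<alpha> i" if "triple (code e) (lcons i 0) u \<in> set_decode (stage A s)" for u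
  proof -
    have "evaluates A e [i] u" using that by (intro stage_sound) (simp add: lcons_def)
    then show ?thesis using e by (rule evaluates_deterministic)
  qed
  with assms(2) show ?thesis by blast
qed

lemma digits_eq:
  assumes e: "\<And>n. evaluates A e [n] (\<alpha> n)" and bits: "\<And>n. \<alpha> n \<in> {0, 1}"
    and "\<forall>i<m. \<exists>v<2. triple (code e) (lcons i 0) v \<in> set_decode (stage A s)"
  shows "digits A (code e) s m = binary_prefix \<alpha> m"
  using assms(3)
proof (induction m)
  case (Suc m)
  then have "triple (code e) (lcons m 0) 1 \<in> set_decode (stage A s) \<longleftrightarrow> 1 = \<alpha> m"
    by (intro stage_iff e) simp
  then show ?case using Suc bits[of m] by auto
qed simp

lemma frac_factor_le:
  assumes e: "\<And>n. evaluates A e [n] (\<alpha> n)" and bits: "\<And>n. \<alpha> n \<in> {0, 1}"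
    and sums: "(\<lambda>n. real (\<alpha> n) / 2 ^ (n + 1)) sums x"
    and n: "schedule n = code e"
  shows "frac (real (p * factor A p n) * x) \<le> 2 / 3"
proof (cases "\<exists>w. witness A p (code e) w")
  case True
  define w where "w = (LEAST w. witness A p (code e) w)"
  define q where "q = nfst w"
  define m where "m = nfst (nsnd w)"
  define a where "a = binary_prefix \<alpha> m"
  \<comment> \<open>The prefix confines \<open>q * p * x\<close> to the interval from
    \<open>k + r / 2 ^ m\<close> to \<open>k + (r + q * p) / 2 ^ m\<close>, and the witness
    condition puts the upper end at or below \<open>k + 2 / 3\<close>.\<close>
  define k where "k = (q * p * a) div 2 ^ m"
  define r where "r = (q * p * a) mod 2 ^ m"
  have factor: "factor A p n = q" using True by (simp add: factor_def n q_def w_def)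
  have "witness A p (code e) w" unfolding w_def using True by (rule LeastI_ex)
  then have known: "\<forall>i<m. \<exists>v<2.
        triple (code e) (lcons i 0) v \<in> set_decode (stage A (nsnd (nsnd w)))"
    and "3 * ((q * p * digits A (code e) (nsnd (nsnd w)) m) mod 2 ^ m + q * p) \<le> 2 * 2 ^ m"
    by (simp_all add: witness_def q_def m_def)
  then have "3 * (r + q * p) \<le> 2 * 2 ^ m"
    using digits_eq[OF e bits known] by (simp add: r_def a_def)
  then have "real (3 * (r + q * p)) \<le> real (2 * 2 ^ m)" by (rule of_nat_mono)
  then have r: "(real r + real (q * p)) / 2 ^ m \<le> 2 / 3"
    by (simp add: field_simps)
  have "q * p * a = k * 2 ^ m + r"
      unfolding k_def r_def by (rule div_mult_mod_eq[symmetric])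
  then have a: "real (q * p) * real a = real k * 2 ^ m + real r"
    by (metis of_nat_add of_nat_mult of_nat_numeral of_nat_power)
  have "real (q * p) * (real a / 2 ^ m) \<le> real (q * p) * x"
    using binary_prefix_bounds(1)[OF bits sums] unfolding a_def by (intro mult_left_mono) simp_all
  also have "real (q * p) * (real a / 2 ^ m) = real k + real r / 2 ^ m"
    unfolding times_divide_eq_right a by (simp add: field_simps)
  finally have lower: "real k + real r / 2 ^ m \<le> real (q * p) * x" .
  have "real (q * p) * x \<le> real (q * p) * ((real a + 1) / 2 ^ m)"
    using binary_prefix_bounds(2)[OF bits sums] unfolding a_def by (intro mult_left_mono) simp_all
  also have "\<dots> = real k + (real r + real (q * p)) / 2 ^ m"
    unfolding times_divide_eq_right distrib_left a by (simp add: field_simps)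
  finally have upper: "real (q * p) * x \<le> real k + 2 / 3" using r by linarith
  have "0 \<le> real r / 2 ^ m" by simp
  then have "real k \<le> real (q * p) * x" using lower by linarith
  then have "frac (real (q * p) * x) = real (q * p) * x - real k"
    using upper by (intro frac_eqI[where k = "int k"]) simp_all
  then show ?thesis using upper by (simp add: factor mult.commute)
next
  case False
  \<comment> \<open>Otherwise some multiplier \<open>q\<close> brings the fractional part into the
    half-open interval from 0 to 1/2, excluding 0, and enough digits turn \<open>q\<close> into a
    witness.\<close>
  have "frac (real p * x) = 0"
  proof (rule ccontr)
    assume "frac (real p * x) \<noteq> 0"
    from exists_multiplier[OF this] obtain q :: nat where "2 \<le> q"
      and pos: "0 < frac (real q * (real p * x))"
      and le: "frac (real q * (real p * x)) \<le> 1 / 2"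
      by blast
    define y where "y = real (q * p) * x"
    have y: "0 < frac y" "frac y \<le> 1 / 2" using pos le by (simp_all add: y_def mult.assoc)
    \<comment> \<open>The error \<open>q * p / 2 ^ m\<close> is to stay below \<open>d\<close>. The
      bound by \<open>frac y\<close> prevents the approximation from falling below the integer part
      of \<open>y\<close>, and 1/6 is the slack between 1/2 and 2/3.\<close>
    define d where "d = min (frac y) (1 / 6)"
    have d: "0 < d" "d \<le> frac y" "d \<le> 1 / 6" using y(1) unfolding d_def by linarith+
    obtain m where "real (q * p) / d < 2 ^ m"
      using real_arch_pow[of 2] by auto
    then have m: "real (q * p) / 2 ^ m < d"
      using d(1) by (simp add: field_simps)
    define a where "a = binary_prefix \<alpha> m"
    define k where "k = (q * p * a) div 2 ^ m"
    define r where "r = (q * p * a) mod 2 ^ m"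
    have "q * p * a = k * 2 ^ m + r"
      unfolding k_def r_def by (rule div_mult_mod_eq[symmetric])
    then have a: "real (q * p) * real a = real k * 2 ^ m + real r"
      by (metis of_nat_add of_nat_mult of_nat_numeral of_nat_power)
    have "real (q * p) * (real a / 2 ^ m) \<le> y"
      using binary_prefix_bounds(1)[OF bits sums] unfolding a_def y_def
      by (intro mult_left_mono) simp_all
    then have lower: "real k + real r / 2 ^ m \<le> y"
      unfolding times_divide_eq_right a by (simp add: field_simps)
    have "y \<le> real (q * p) * ((real a + 1) / 2 ^ m)"
      using binary_prefix_bounds(2)[OF bits sums] unfolding a_def y_def
      by (intro mult_left_mono) simp_all
    also have "\<dots> = real k + real r / 2 ^ m + real (q * p) / 2 ^ m"
      unfolding times_divide_eq_right distrib_left a by (simp add: field_simps)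
    finally have upper: "y \<le> real k + real r / 2 ^ m + real (q * p) / 2 ^ m" .
    have r: "0 \<le> real r / 2 ^ m" "real r / 2 ^ m < 1"
    proof -
      have "r < 2 ^ m" by (simp add: r_def)
      then have "real r < 2 ^ m" by (metis of_nat_less_iff of_nat_numeral of_nat_power)
      then show "real r / 2 ^ m < 1" by simp
    qed simp
    have y_eq: "y = of_int \<lfloor>y\<rfloor> + frac y" by (simp add: frac_def)
    have "\<lfloor>y\<rfloor> = int k"
    proof -
      have "real_of_int \<lfloor>y\<rfloor> < real k + 1"
        using y_eq upper m r d by linarith
      then have "real_of_int \<lfloor>y\<rfloor> < real_of_int (int k + 1)" by simp
      moreover have "real_of_int (int k) < real_of_int (\<lfloor>y\<rfloor> + 1)"
        using lower r by linarith
      ultimately show ?thesis unfolding of_int_less_iff by linarith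
    qed
    with y_eq have "y = real k + frac y" by simp
    then have "real r / 2 ^ m + real (q * p) / 2 ^ m \<le> 2 / 3"
      using lower y m d by linarith
    then have "real (3 * (r + q * p)) \<le> real (2 * 2 ^ m)"
      by (simp add: field_simps)
    then have bound: "3 * (r + q * p) \<le> 2 * 2 ^ m" by (rule of_nat_le_iff[THEN iffD1])
    \<comment> \<open>Only \<open>m\<close> digits are involved, so one stage \<open>s\<close> can
      know them all.\<close>
    have "\<forall>\<^sub>F s in sequentially. \<forall>i\<in>{..<m}.
        triple (code e) (lcons i 0) (\<alpha> i) \<in> set_decode (stage A s)"
      using stage_complete[OF e] by (intro eventually_ball_finite) (simp_all add: lcons_def)
    then obtain s where s: "\<forall>i<m. triple (code e) (lcons i 0) (\<alpha> i) \<in> set_decode (stage A s)"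
      by (auto simp: eventually_sequentially)
    have "\<alpha> i < 2" for i using bits[of i] by auto
    with s have known: "\<forall>i<m. \<exists>v<2. triple (code e) (lcons i 0) v \<in> set_decode (stage A s)"
      by blast
    have "witness A p (code e) (prod_encode (q, prod_encode (m, s)))"
      using \<open>2 \<le> q\<close> known bound digits_eq[OF e bits known]
      by (simp add: witness_def r_def a_def)
    with False show False by blast
  qed
  \<comment> \<open>With \<open>p * x\<close> an integer, the default term 2 sends the orbit to
    0.\<close>
  then have "frac (2 * (real p * x)) = 0"
    using frac_of_int_mult[of 2 "real p * x"] by simp
  moreover have "real (p * factor A p n) * x = 2 * (real p * x)"
    using False by (simp add: factor_def n)
  ultimately have "frac (real (p * factor A p n) * x) = 0" by (simp only:)
  then show ?thesis by linarith
qed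

section \<open>Counting hits at the end of a block\<close>

theorem theorem2:
  fixes A :: "nat set"
  shows "\<exists>Q :: nat \<Rightarrow> nat. basic_sequence Q \<and>
    limit_computable_in A Q \<and> computable_in (turing_jump A) Q \<and>
    (\<forall>x :: real. 0 < x \<and> x < 1 \<and> computable_real_in A x \<longrightarrow> \<not> distribution_normal Q x)"
proof (intro exI[of _ "base A"] conjI allI impI notI)
  show "basic_sequence (base A)"
    by (simp add: basic_sequence_def base_def factor_ge_2)
  show "limit_computable_in A (base A)" by (rule limit_computable_base)
  then show "computable_in (turing_jump A) (base A)"
    by (rule limit_computable_imp_computable_turing_jump)
next
  fix x :: real
  assume "0 < x \<and> x < 1 \<and> computable_real_in A x" and normal: "distribution_normal (base A) x"
  then obtain \<alpha> e where bits: "\<And>n. \<alpha> n \<in> {0, 1}"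
    and e: "\<And>n. evaluates A e [n] (if n \<in> {n. \<alpha> n = 1} then 1 else 0)"
    and sums: "(\<lambda>n. real (\<alpha> n) / 2 ^ (n + 1)) sums x"
    unfolding computable_real_in_def computable_set_in_def computable_in_def by blast
  have e: "evaluates A e [n] (\<alpha> n)" for n
    using e[of n] bits[of n] by (auto split: if_splits)
  \<comment> \<open>The interval includes 0, where the orbit lands when \<open>p * x\<close> is an
    integer.\<close>
  define hits where "hits n = {k. k < n \<and> frac (real (base_product A k) * x) \<in> {0..2 / 3}}" for n
  have "is_interval {0..2 / 3 :: real} \<and> {0..2 / 3} \<subseteq> {0..1 :: real}"
    by (auto simp: is_interval_cc)
  then have "(\<lambda>n. real (card (hits n)) / real n) \<longlonglongrightarrow> measure lborel {0..2 / 3 :: real}"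
    using normal unfolding distribution_normal_def uniformly_distributed_mod1_def hits_def
      base_product_eq by blast
  \<comment> \<open>The constant 11/16 lies strictly between the length 2/3 and the proportion 3/4
    contributed by one full block.\<close>
  then have "\<forall>\<^sub>F n in sequentially. real (card (hits n)) / real n < 11 / 16"
    by (rule order_tendstoD(2)) simp
  then obtain N where N: "\<And>n. N \<le> n \<Longrightarrow> real (card (hits n)) / real n < 11 / 16"
    unfolding eventually_sequentially by blast
  \<comment> \<open>Block \<open>j\<close> is chosen to belong to \<open>e\<close>; the second
    component \<open>N + 2\<close> forces it to lie beyond \<open>N\<close> and gives
    \<open>j >= 1\<close>.\<close>
  have "0 < prod_encode (code e, N + 2)"
    using le_prod_encode_2[of "N + 2" "code e"] by linarith
  then obtain j where j: "Suc j = prod_encode (code e, N + 2)"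
    using gr0_implies_Suc by metis
  then have "N + 1 \<le> j" using le_prod_encode_2[of "N + 2" "code e"] by linarith
  \<comment> \<open>The term chosen at index \<open>n\<close> first affects the orbit at index
    \<open>n + 1\<close>, so the first index of the block is not claimed as a hit and
    \<open>3 * 4 ^ j - 1\<close> hits are guaranteed.\<close>
  have "{4 ^ j + 1..<4 ^ Suc j} \<subseteq> hits (4 ^ Suc j)"
  proof
    fix k :: nat assume k: "k \<in> {4 ^ j + 1..<4 ^ Suc j}"
    then obtain n where n: "k = Suc n" "4 ^ j \<le> n" "n < 4 ^ Suc j" by (cases k) auto
    then have "schedule n = code e" by (simp add: schedule_eq j)
    from frac_factor_le[OF e bits sums this]
    show "k \<in> hits (4 ^ Suc j)" using k n by (simp add: hits_def)
  qed
  then have "card {4 ^ j + 1..<4 ^ Suc j :: nat} \<le> card (hits (4 ^ Suc j))"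
    by (intro card_mono) (auto simp: hits_def)
  then have "3 * 4 ^ j \<le> card (hits (4 ^ Suc j)) + 1" by simp
  then have "real (3 * 4 ^ j) \<le> real (card (hits (4 ^ Suc j)) + 1)" by (rule of_nat_mono)
  then have card: "3 * 4 ^ j \<le> real (card (hits (4 ^ Suc j))) + 1" by simp
  \<comment> \<open>The margin between 3/4 and 11/16 of \<open>4 ^ Suc j\<close> is
    \<open>4 ^ j / 4\<close>, which must make up for the one missing hit.\<close>
  have "4 ^ 1 \<le> (4 :: real) ^ j" using \<open>N + 1 \<le> j\<close> by (intro power_increasing) simp_all
  with card have "11 / 16 * 4 ^ Suc j \<le> real (card (hits (4 ^ Suc j)))" by simp
  then have "11 / 16 \<le> real (card (hits (4 ^ Suc j))) / real (4 ^ Suc j)"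
    by (simp add: field_simps)
  moreover have "N \<le> 4 ^ Suc j"
  proof -
    have "Suc j < 4 ^ Suc j" by (rule power_gt_expt) simp
    with \<open>N + 1 \<le> j\<close> show ?thesis by linarith
  qed
  ultimately show False using N[of "4 ^ Suc j"] by linarith
qed

end
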